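(* Let $M$ be a Perron-Frobenius $n\times n$ matrix with non-negative integer entries, and let $\lambda>1$ be its largest eigenvalue. Then $$\lambda^n \ge |M| - n + 1,$$ where $|M|$ denotes the sum of the entries of $M$.
   Context: A square matrix $M$ with non-negative entries is called Perron-Frobenius (also: primitive) if for some integer $k>0$ every entry of $M^k$ is strictly positive. Its largest eigenvalue is then real and equals its spectral radius. *)

theory Defs
  imports "Jordan_Normal_Form.Spectral_Radius"
begin

definition perron_frobenius_mat :: "'a :: linordered_semidom mat \<Rightarrow> bool" where
  "perron_frobenius_mat A \<longleftrightarrow>
     square_mat A \<and>
     (\<forall>e \<in> elements_mat A. 0 \<le> e) \<and>
     (\<exists>k>0. \<forall>e \<in> elements_mat (A ^\<^sub>m k). 0 < e)"

(* Complex eigenvalues are compared by modulus. For an arbitrary matrix several eigenvalues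
   can be largest in this sense; for a Perron-Frobenius matrix there is exactly one. *)
definition largest_eigenvalue :: "complex mat \<Rightarrow> complex \<Rightarrow> bool" where
  "largest_eigenvalue A z \<longleftrightarrow>
     eigenvalue A z \<and> (\<forall>w. eigenvalue A w \<longrightarrow> cmod w \<le> cmod z)"

end

theory Submission
  imports Defs
begin

text \<open>
  View \<open>M\<close> as the adjacency matrix of a directed multigraph on \<open>n\<close> vertices, so that the entries of
  \<open>M\<^sup>k\<close> count paths of length \<open>k\<close>. Fix a starting vertex \<open>i\<close>. Each path of length \<open>k\<close> ending at \<open>u\<close>
  has as many one-edge extensions as \<open>u\<close> has outgoing edges, say \<open>d u\<close>. Hence passing from length
  \<open>k\<close> to \<open>k + 1\<close> increases the number of paths from \<open>i\<close> by \<open>\<Sum>\<^sub>u (d u - 1) (M\<^sup>k)\<^sub>i\<^sub>u\<close>, and the number of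
  paths of length \<open>n\<close> is \<open>1 + \<Sum>\<^sub>u (d u - 1) (\<Sum>k<n. (M\<^sup>k)\<^sub>i\<^sub>u)\<close> (lemma \<open>row_sum_pow_telescope\<close>).
  The graph is strongly connected, so every \<open>d u\<close> is at least 1 and every \<open>u\<close> is reached from \<open>i\<close> in
  fewer than \<open>n\<close> steps (lemma \<open>positive_pow_entry_below_dim\<close>), which makes the inner sums at least 1.
  Therefore every row sum of \<open>M\<^sup>n\<close> is at least \<open>1 + \<Sum>\<^sub>u (d u - 1) = \<bar>M\<bar> - n + 1\<close>.

  It remains to compare row sums with the spectral radius \<open>\<lambda>\<close>. If every row sum of \<open>M\<^sup>n\<close> is at least
  \<open>c \<ge> 0\<close>, then every row sum of \<open>M\<^sup>k\<^sup>n\<close> is at least \<open>c\<^sup>k\<close>, whereas for each \<open>r > \<lambda>\<close> the entries of \<open>M\<^sup>k\<^sup>n\<close>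
  are \<open>O(r\<^sup>k\<^sup>n)\<close>. So \<open>c \<le> r\<^sup>n\<close>, and \<open>c \<le> \<lambda>\<^sup>n\<close> in the limit (lemma \<open>min_row_sum_pow_le_spectral_bound\<close>).
\<close>

section \<open>Row sums and powers of matrices\<close>

definition row_sum :: "'a :: comm_monoid_add mat \<Rightarrow> nat \<Rightarrow> 'a" where
  "row_sum A i = (\<Sum>j<dim_col A. A $$ (i, j))"

lemma index_mult_mat_sum:
  assumes "A \<in> carrier_mat n n" "B \<in> carrier_mat n n" "i < n" "j < n"
  shows "(A * B) $$ (i, j) = (\<Sum>k<n. A $$ (i, k) * B $$ (k, j))"
  using assms by (auto simp: scalar_prod_def atLeast0LessThan)

lemma row_sum_mult:
  fixes A B :: "'a :: semiring_1 mat"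
  assumes A: "A \<in> carrier_mat n n" and B: "B \<in> carrier_mat n n" and i: "i < n"
  shows "row_sum (A * B) i = (\<Sum>k<n. A $$ (i, k) * row_sum B k)"
proof -
  have "row_sum (A * B) i = (\<Sum>j<n. \<Sum>k<n. A $$ (i, k) * B $$ (k, j))"
    using B by (auto simp: row_sum_def index_mult_mat_sum[OF A B i] intro!: sum.cong)
  also have "\<dots> = (\<Sum>k<n. \<Sum>j<n. A $$ (i, k) * B $$ (k, j))"
    by (rule sum.swap)
  also have "\<dots> = (\<Sum>k<n. A $$ (i, k) * row_sum B k)"
    using B by (simp add: row_sum_def sum_distrib_left)
  finally show ?thesis .
qed

lemma row_sum_one:
  assumes "i < n"
  shows "row_sum (1\<^sub>m n) i = (1 :: 'a :: semiring_1)"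
  using assms by (simp add: row_sum_def)

lemma sum_mat_row_sum:
  assumes "A \<in> carrier_mat n n"
  shows "sum_mat A = (\<Sum>i<n. row_sum A i)"
  using assms by (simp add: sum_mat_def row_sum_def sum.cartesian_product atLeast0LessThan)

lemma pow_mat_add:
  fixes A :: "'a :: semiring_1 mat"
  assumes A: "A \<in> carrier_mat n n"
  shows "A ^\<^sub>m (k + l) = A ^\<^sub>m k * A ^\<^sub>m l"
proof (induction l)
  case 0
  show ?case using A by simp
next
  case (Suc l)
  then show ?case
    using assoc_mult_mat[OF pow_carrier_mat[OF A] pow_carrier_mat[OF A] A] by simp
qed

lemma pow_mat_smult:
  fixes A :: "'a :: comm_semiring_1 mat"
  assumes A: "A \<in> carrier_mat n n"
  shows "(a \<cdot>\<^sub>m A) ^\<^sub>m k = a ^ k \<cdot>\<^sub>m (A ^\<^sub>m k)"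
proof (induction k)
  case 0
  show ?case using A by auto
next
  case (Suc k)
  have "(a ^ k \<cdot>\<^sub>m (A ^\<^sub>m k)) * (a \<cdot>\<^sub>m A) = a ^ Suc k \<cdot>\<^sub>m (A ^\<^sub>m k * A)"
    using A pow_carrier_mat[OF A, of k]
    by (intro eq_matI)
      (auto simp: scalar_prod_def sum_distrib_left mult_ac intro!: sum.cong)
  then show ?case using Suc by simp
qed

lemma pow_mat_nonneg:
  fixes A :: "'a :: linordered_semidom mat"
  assumes A: "A \<in> carrier_mat n n"
    and nonneg: "\<And>i j. i < n \<Longrightarrow> j < n \<Longrightarrow> 0 \<le> A $$ (i, j)"
    and "i < n" "j < n"
  shows "0 \<le> (A ^\<^sub>m k) $$ (i, j)"
  using \<open>j < n\<close>
proof (induction k arbitrary: j)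
  case 0
  then show ?case using A \<open>i < n\<close> by simp
next
  case (Suc k)
  then show ?case
    using A nonneg \<open>i < n\<close>
    by (simp add: index_mult_mat_sum[OF pow_carrier_mat[OF A] A] del: index_mult_mat)
      (intro sum_nonneg mult_nonneg_nonneg, auto)
qed

section \<open>Counting paths of length \<open>n\<close>\<close>

text \<open>
  The set of vertices reachable from \<open>i\<close> in at most \<open>k\<close> steps starts with one element and grows
  strictly with \<open>k\<close> until it is closed under edges. Once closed it contains everything reachable,
  in particular \<open>j\<close>; and it cannot grow more than \<open>n - 1\<close> times.
\<close>

lemma positive_pow_entry_below_dim:
  fixes A :: "'a :: linordered_semidom mat"
  assumes A: "A \<in> carrier_mat n n"
    and nonneg: "\<And>i j. i < n \<Longrightarrow> j < n \<Longrightarrow> 0 \<le> A $$ (i, j)"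
    and i: "i < n" and j: "j < n"
    and pos: "0 < (A ^\<^sub>m m) $$ (i, j)"
  shows "\<exists>k<n. 0 < (A ^\<^sub>m k) $$ (i, j)"
proof -
  define S where "S k = {u. u < n \<and> (\<exists>l\<le>k. 0 < (A ^\<^sub>m l) $$ (i, u))}" for k
  have S_sub: "S k \<subseteq> {..<n}" for k by (auto simp: S_def)
  have fin: "finite (S k)" for k using S_sub finite_subset by blast
  have S_mono: "S k \<subseteq> S (Suc k)" for k
    unfolding S_def using le_SucI by blast
  have i_S: "i \<in> S k" for k
    using A i by (auto simp: S_def intro!: exI[of _ 0])
  have step: "u \<in> S (Suc k)" if "w \<in> S k" "u < n" "0 < A $$ (w, u)" for k u w
  proof -
    from that obtain l where l: "l \<le> k" "0 < (A ^\<^sub>m l) $$ (i, w)" and w: "w < n"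
      by (auto simp: S_def)
    have "0 < (\<Sum>w<n. (A ^\<^sub>m l) $$ (i, w) * A $$ (w, u))"
      by (rule sum_pos2[of _ w])
        (use l w that nonneg i pow_mat_nonneg[OF A nonneg] in auto)
    then have "0 < (A ^\<^sub>m Suc l) $$ (i, u)"
      using index_mult_mat_sum[OF pow_carrier_mat[OF A] A i \<open>u < n\<close>] by simp
    then show ?thesis
      using l \<open>u < n\<close> unfolding S_def by (auto intro!: exI[of _ "Suc l"] simp del: pow_mat.simps)
  qed
  have closed: "u \<in> S k" if stable: "S (Suc k) = S k" and "u < n" "0 < (A ^\<^sub>m l) $$ (i, u)"
    for k l u
    using that(2,3)
  proof (induction l arbitrary: u)
    case 0
    then have "u = i" using A i by (auto split: if_splits)
    then show ?case using i_S by simp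
  next
    case (Suc l)
    have "0 < (\<Sum>w<n. (A ^\<^sub>m l) $$ (i, w) * A $$ (w, u))"
      using Suc.prems index_mult_mat_sum[OF pow_carrier_mat[OF A] A i \<open>u < n\<close>] by simp
    then obtain w where w: "w < n" "(A ^\<^sub>m l) $$ (i, w) * A $$ (w, u) \<noteq> 0"
      by (metis (no_types, lifting) lessThan_iff less_irrefl sum.neutral)
    then have "0 < (A ^\<^sub>m l) $$ (i, w)" "0 < A $$ (w, u)"
      using pow_mat_nonneg[OF A nonneg i \<open>w < n\<close>, of l] nonneg[OF \<open>w < n\<close> \<open>u < n\<close>]
      by (auto simp: le_less)
    then show ?case using Suc.IH[of w] step[of w k u] w Suc.prems stable by auto
  qed
  \<comment> \<open>Until \<open>j\<close> is reached, each step adds at least one new vertex.\<close>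
  have "j \<in> S k \<or> Suc k \<le> card (S k)" for k
  proof (induction k)
    case 0
    then show ?case using i_S[of 0] fin[of 0] card_gt_0_iff[of "S 0"] by auto
  next
    case (Suc k)
    show ?case
    proof (cases "S (Suc k) = S k")
      case True
      then show ?thesis using closed[OF True j pos] by simp
    next
      case False
      then have "card (S k) < card (S (Suc k))"
        using S_mono[of k] fin by (intro psubset_card_mono) auto
      then show ?thesis using Suc S_mono[of k] by auto
    qed
  qed
  from this[of "n - 1"] have "j \<in> S (n - 1)"
  proof
    assume "Suc (n - 1) \<le> card (S (n - 1))"
    then have "S (n - 1) = {..<n}"
      using i by (intro card_seteq S_sub) auto
    then show ?thesis using j by simp
  qed
  then obtain l where "l \<le> n - 1" "0 < (A ^\<^sub>m l) $$ (i, j)"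
    by (auto simp: S_def)
  then show ?thesis
    using i by (intro exI[of _ l]) auto
qed

text \<open>
  Since \<open>A\<^sup>m\<^sup>+\<^sup>1 = A\<^sup>m A\<close>, row \<open>i\<close> of \<open>A\<^sup>m\<^sup>+\<^sup>1\<close> has sum \<open>\<Sum>\<^sub>u (A\<^sup>m)\<^sub>i\<^sub>u\<close> weighted by the row sums of \<open>A\<close>;
  splitting off weight 1 leaves the previous row sum plus an increment, and the increments add up.
\<close>

lemma row_sum_pow_telescope:
  fixes A :: "'a :: comm_ring_1 mat"
  assumes A: "A \<in> carrier_mat n n" and i: "i < n"
  shows "row_sum (A ^\<^sub>m m) i =
    1 + (\<Sum>u<n. (row_sum A u - 1) * (\<Sum>k<m. (A ^\<^sub>m k) $$ (i, u)))"
proof (induction m)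
  case 0
  show ?case using A i by (simp add: row_sum_one)
next
  case (Suc m)
  have "row_sum (A ^\<^sub>m Suc m) i = (\<Sum>u<n. (A ^\<^sub>m m) $$ (i, u) * row_sum A u)"
    using row_sum_mult[OF pow_carrier_mat[OF A] A i] by simp
  also have "\<dots> = row_sum (A ^\<^sub>m m) i + (\<Sum>u<n. (row_sum A u - 1) * (A ^\<^sub>m m) $$ (i, u))"
    using A by (simp add: row_sum_def sum.distrib[symmetric] algebra_simps)
  finally show ?case
    by (simp add: Suc sum.distrib distrib_left)
qed

text \<open>
  In the telescoped formula all weights \<open>row_sum M u - 1\<close> are non-negative, because a zero row of \<open>M\<close>
  would persist in every power, and each is multiplied by a positive integer, because every vertex
  is visited by time \<open>n - 1\<close>.
\<close>

lemma row_sum_pow_dim_ge: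
  fixes M :: "int mat"
  assumes M: "M \<in> carrier_mat n n" and pf: "perron_frobenius_mat M" and i: "i < n"
  shows "sum_mat M - int n + 1 \<le> row_sum (M ^\<^sub>m n) i"
proof -
  have nonneg: "0 \<le> M $$ (u, w)" if "u < n" "w < n" for u w
    using pf elements_matI[OF M that] by (auto simp: perron_frobenius_mat_def)
  obtain K where K: "K > 0" "\<forall>e \<in> elements_mat (M ^\<^sub>m K). 0 < e"
    using pf by (auto simp: perron_frobenius_mat_def)
  have pos: "0 < (M ^\<^sub>m K) $$ (u, w)" if "u < n" "w < n" for u w
    using K elements_matI[OF pow_carrier_mat[OF M] that] by auto
  have out: "1 \<le> row_sum M u" if u: "u < n" for u
  proof (rule ccontr)
    assume "\<not> ?thesis"
    then have "row_sum M u = 0"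
      using M nonneg u sum_nonneg[of "{..<n}" "\<lambda>j. M $$ (u, j)"] by (force simp: row_sum_def)
    then have zero: "M $$ (u, w) = 0" if "w < n" for w
      using M nonneg u that sum_nonneg_eq_0_iff[of "{..<n}" "\<lambda>j. M $$ (u, j)"]
      by (auto simp: row_sum_def)
    have "M ^\<^sub>m K = M * M ^\<^sub>m (K - 1)"
      using pow_mat_add[OF M, of 1 "K - 1"] K M by simp
    then have "(M ^\<^sub>m K) $$ (u, u) = 0"
      using index_mult_mat_sum[OF M pow_carrier_mat[OF M] u u] zero by simp
    then show False using pos[OF u u] by simp
  qed
  have visits: "1 \<le> (\<Sum>k<n. (M ^\<^sub>m k) $$ (i, u))" if u: "u < n" for u
  proof -
    obtain k where "k < n" "0 < (M ^\<^sub>m k) $$ (i, u)"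
      using positive_pow_entry_below_dim[OF M nonneg i u pos[OF i u]] by auto
    then have "0 < (\<Sum>k<n. (M ^\<^sub>m k) $$ (i, u))"
      using pow_mat_nonneg[OF M nonneg i u] by (intro sum_pos2[of _ k]) auto
    then show ?thesis by simp
  qed
  have "sum_mat M - int n + 1 = 1 + (\<Sum>u<n. row_sum M u - 1)"
    using sum_mat_row_sum[OF M] by (simp add: sum_subtractf)
  also have "(\<Sum>u<n. row_sum M u - 1)
      \<le> (\<Sum>u<n. (row_sum M u - 1) * (\<Sum>k<n. (M ^\<^sub>m k) $$ (i, u)))"
  proof (rule sum_mono)
    fix u assume "u \<in> {..<n}"
    then show "row_sum M u - 1 \<le> (row_sum M u - 1) * (\<Sum>k<n. (M ^\<^sub>m k) $$ (i, u))"
      using mult_left_mono[OF visits[of u], of "row_sum M u - 1"] out[of u] by simp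
  qed
  finally show ?thesis using row_sum_pow_telescope[OF M i, of n] by simp
qed

section \<open>Row sums and the spectral radius\<close>

text \<open>
  Scaling by \<open>1 / r\<close> brings the spectral radius strictly below 1, and the powers of such a matrix
  are bounded, as one sees from its Jordan normal form.
\<close>

lemma pow_entries_growth_bound:
  fixes A :: "complex mat"
  assumes A: "A \<in> carrier_mat n n" and n: "n > 0"
    and ev: "\<And>w. eigenvalue A w \<Longrightarrow> cmod w < r" and r: "r > 0"
  obtains C where "\<And>k i j. i < n \<Longrightarrow> j < n \<Longrightarrow> cmod ((A ^\<^sub>m k) $$ (i, j)) \<le> C * r ^ k"
proof -
  define B where "B = complex_of_real (1 / r) \<cdot>\<^sub>m A"
  have B: "B \<in> carrier_mat n n" using A by (simp add: B_def)
  obtain w where w: "eigenvalue B w" "spectral_radius B = cmod w"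
    using spectral_radius_mem_max(1)[OF B n] by (auto simp: spectrum_def)
  then obtain v where v: "v \<in> carrier_vec n" "v \<noteq> 0\<^sub>v n" "B *\<^sub>v v = w \<cdot>\<^sub>v v"
    using B by (auto simp: eigenvalue_def eigenvector_def)
  have "A = complex_of_real r \<cdot>\<^sub>m B"
    using r A by (auto simp: B_def)
  moreover have "(complex_of_real r \<cdot>\<^sub>m B) *\<^sub>v v = complex_of_real r \<cdot>\<^sub>v (B *\<^sub>v v)"
    using v(1) B by (auto intro!: eq_vecI simp: scalar_prod_def sum_distrib_left mult_ac)
  ultimately have "A *\<^sub>v v = complex_of_real r \<cdot>\<^sub>v (B *\<^sub>v v)" by simp
  also have "\<dots> = (complex_of_real r * w) \<cdot>\<^sub>v v"
    using v by (simp add: smult_smult_assoc)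
  finally have "eigenvalue A (complex_of_real r * w)"
    using v A by (auto simp: eigenvalue_def eigenvector_def)
  from ev[OF this] have "spectral_radius B < 1"
    using r w by (simp add: norm_mult)
  from spectral_radius_jnf_norm_bound_less_1_upper_triangular[OF B this]
  obtain C where C: "\<And>k. norm_bound (B ^\<^sub>m k) C" by auto
  show ?thesis
  proof (rule that)
    fix k i j assume ij: "i < n" "j < n"
    have "cmod ((B ^\<^sub>m k) $$ (i, j)) \<le> C"
      using C[of k] ij B by (simp add: norm_bound_def)
    moreover have "(B ^\<^sub>m k) $$ (i, j) = complex_of_real (1 / r) ^ k * (A ^\<^sub>m k) $$ (i, j)"
      unfolding B_def pow_mat_smult[OF A] using ij A by simp
    ultimately show "cmod ((A ^\<^sub>m k) $$ (i, j)) \<le> C * r ^ k"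
      using r by (simp add: norm_mult norm_power norm_divide power_divide divide_simps)
  qed
qed

lemma row_sum_pow_mult_ge:
  fixes A :: "'a :: linordered_idom mat"
  assumes A: "A \<in> carrier_mat n n"
    and nonneg: "\<And>i j. i < n \<Longrightarrow> j < n \<Longrightarrow> 0 \<le> A $$ (i, j)"
    and c: "0 \<le> c" "\<And>i. i < n \<Longrightarrow> c \<le> row_sum (A ^\<^sub>m m) i"
    and i: "i < n"
  shows "c ^ k \<le> row_sum (A ^\<^sub>m (k * m)) i"
proof (induction k)
  case 0
  show ?case using A i by (simp add: row_sum_one)
next
  case (Suc k)
  have "c ^ Suc k \<le> row_sum (A ^\<^sub>m (k * m)) i * c"
    using Suc c by (simp add: mult.commute mult_left_mono)
  also have "\<dots> = (\<Sum>u<n. (A ^\<^sub>m (k * m)) $$ (i, u) * c)"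
    using A by (simp add: row_sum_def sum_distrib_right)
  also have "\<dots> \<le> (\<Sum>u<n. (A ^\<^sub>m (k * m)) $$ (i, u) * row_sum (A ^\<^sub>m m) u)"
    using c pow_mat_nonneg[OF A nonneg i] by (intro sum_mono mult_left_mono) auto
  also have "\<dots> = row_sum (A ^\<^sub>m (k * m + m)) i"
    using row_sum_mult[OF pow_carrier_mat[OF A] pow_carrier_mat[OF A] i] pow_mat_add[OF A]
    by simp
  finally show ?case by (simp add: add.commute)
qed

text \<open>
  Row sums of \<open>A\<^sup>k\<^sup>m\<close> grow at least like \<open>c\<^sup>k\<close> but at most like \<open>r\<^sup>k\<^sup>m\<close> for every \<open>r > \<rho>\<close>. The strict
  inequality is needed because at \<open>r = \<rho>\<close> non-trivial Jordan blocks may contribute polynomial factors;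
  it is removed at the end by letting \<open>r\<close> tend to \<open>\<rho>\<close>.
\<close>

lemma min_row_sum_pow_le_spectral_bound:
  fixes A :: "real mat"
  assumes A: "A \<in> carrier_mat n n" and n: "n > 0"
    and nonneg: "\<And>i j. i < n \<Longrightarrow> j < n \<Longrightarrow> 0 \<le> A $$ (i, j)"
    and ev: "\<And>w. eigenvalue (map_mat complex_of_real A) w \<Longrightarrow> cmod w \<le> \<rho>"
    and \<rho>: "0 \<le> \<rho>"
    and c: "\<And>i. i < n \<Longrightarrow> c \<le> row_sum (A ^\<^sub>m m) i"
  shows "c \<le> \<rho> ^ m"
proof -
  have le: "c \<le> r ^ m" if r: "\<rho> < r" for r
  proof (rule ccontr)
    assume "\<not> c \<le> r ^ m"
    then have gt: "r ^ m < c" by simp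
    have r0: "0 < r" and c0: "0 < c"
      using r \<rho> gt zero_le_power[of r m] by linarith+
    have cA: "map_mat complex_of_real A \<in> carrier_mat n n" using A by simp
    have ev': "cmod w < r" if "eigenvalue (map_mat complex_of_real A) w" for w
      using ev[OF that] r by simp
    obtain C where C: "\<And>k i j. i < n \<Longrightarrow> j < n \<Longrightarrow>
        cmod ((map_mat complex_of_real A ^\<^sub>m k) $$ (i, j)) \<le> C * r ^ k"
      using pow_entries_growth_bound[OF cA n ev' r0] by blast
    have entry: "(A ^\<^sub>m k) $$ (i, j) \<le> C * r ^ k" if "i < n" "j < n" for k i j
    proof -
      have "(map_mat complex_of_real A ^\<^sub>m k) $$ (i, j) = complex_of_real ((A ^\<^sub>m k) $$ (i, j))"
        using that A by (simp add: of_real_hom.mat_hom_pow[OF A, symmetric])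
      then show ?thesis using C[OF that, of k] by simp
    qed
    have bounded: "(c / r ^ m) ^ k \<le> real n * C" for k
    proof -
      have "c ^ k \<le> row_sum (A ^\<^sub>m (k * m)) 0"
        by (rule row_sum_pow_mult_ge[OF A nonneg _ c n]) (use c0 in auto)
      also have "\<dots> = (\<Sum>j<n. (A ^\<^sub>m (k * m)) $$ (0, j))"
        using A by (simp add: row_sum_def)
      also have "\<dots> \<le> (\<Sum>j<n. C * r ^ (k * m))"
        by (intro sum_mono entry n) auto
      also have "\<dots> = real n * C * (r ^ m) ^ k"
        by (simp add: power_mult[symmetric] mult.commute)
      finally show ?thesis using r0 by (simp add: power_divide divide_simps)
    qed
    have "1 < c / r ^ m" using gt r0 by simp
    from real_arch_pow[OF this, of "real n * C"] obtain k where "real n * C < (c / r ^ m) ^ k"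
      by auto
    with bounded[of k] show False by simp
  qed
  have "((\<lambda>r. r ^ m) \<longlongrightarrow> \<rho> ^ m) (at_right \<rho>)"
    by (intro tendsto_intros)
  then show ?thesis
    by (rule tendsto_lowerbound) (auto simp: eventually_at_right_less le eventually_at_topological)
qed

theorem lemma3p1:
  fixes M :: "int mat" and n :: nat and lam :: real
  assumes "M \<in> carrier_mat n n"
    and "perron_frobenius_mat M"
    and "largest_eigenvalue (map_mat complex_of_int M) (complex_of_real lam)"
    and "lam > 1"
  shows "lam ^ n \<ge> real_of_int (sum_mat M) - real n + 1"
proof -
  note M = assms(1)
  let ?A = "map_mat real_of_int M"
  have A: "?A \<in> carrier_mat n n" using M by simp
  have cM: "map_mat complex_of_real ?A = map_mat complex_of_int M" by auto
  have n: "n > 0"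
    using eigenvalue_imp_nonzero_dim[of "map_mat complex_of_int M"] M assms(3)
    by (auto simp: largest_eigenvalue_def)
  have "real_of_int (sum_mat M - int n + 1) \<le> lam ^ n"
  proof (rule min_row_sum_pow_le_spectral_bound[OF A n])
    show "0 \<le> ?A $$ (i, j)" if "i < n" "j < n" for i j
      using that M assms(2) elements_matI[OF M that] by (auto simp: perron_frobenius_mat_def)
    show "cmod w \<le> lam" if "eigenvalue (map_mat complex_of_real ?A) w" for w
      using that assms(3,4) by (auto simp: cM largest_eigenvalue_def)
    show "0 \<le> lam" using assms(4) by simp
    show "real_of_int (sum_mat M - int n + 1) \<le> row_sum (?A ^\<^sub>m n) i" if i: "i < n" for i
    proof -
      have "row_sum (?A ^\<^sub>m n) i = real_of_int (row_sum (M ^\<^sub>m n) i)"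
        using M i by (simp add: row_sum_def of_int_hom.mat_hom_pow[OF M, symmetric])
      then show ?thesis using row_sum_pow_dim_ge[OF M assms(2) i] by linarith
    qed
  qed
  then show ?thesis by simp
qed

end
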